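(* Let $\Omega\subset\mathbf{R}^d$ be a domain with boundary $\Gamma$ and let $\delta\in[0,2)$. Then the boundary Hardy inequality $$\text{(BH)}\quad \text{there is } r_0>0 \text{ and for each } r\in(0,r_0) \text{ an } a>0 \text{ such that } \|d_\Gamma^{\,\delta/2-1}\psi\|_2\le a\,\|d_\Gamma^{\,\delta/2}(\nabla\psi)\|_2 \text{ for all } \psi\in C_c^1(\Gamma_r)$$ is valid if and only if the weak Hardy inequality $$\text{(WH)}\quad \text{there are } b,c>0 \text{ such that } \|d_\Gamma^{\,\delta/2-1}\psi\|_2\le b\,\|d_\Gamma^{\,\delta/2}(\nabla\psi)\|_2+c\,\|\psi\|_2 \text{ for all } \psi\in C_c^1(\Omega)$$ is valid. Moreover, if the inequalities are satisfied then $a_\delta(\Gamma)=b_\delta(\Gamma)=b_\delta(\Omega)$. Finally, $a_\delta(\Gamma\cap U)=b_\delta(\Gamma\cap U)$ for each bounded open subset $U\subset\mathbf{R}^d$.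
   Context: $d_\Gamma(x)$ is the Euclidean distance from $x$ to the (non-empty) boundary $\Gamma$ of $\Omega$, $\Gamma_r=\{x\in\Omega: d_\Gamma(x)<r\}$, $\|\cdot\|_2$ is the $L_2$-norm, and for an open set $W\subseteq\Omega$, $C_c^1(W)$ denotes the $C^1$-functions with compact support in $W$. For an open set $W\subseteq \Omega$ let $a_\delta(W)$ be the infimum of the $a>0$ such that $\|d_\Gamma^{\,\delta/2-1}\psi\|_2\le a\,\|d_\Gamma^{\,\delta/2}(\nabla\psi)\|_2$ for all $\psi\in C_c^1(W)$, and let $b_\delta(W)$ be the infimum of the $b>0$ for which there is a $c>0$ such that $\|d_\Gamma^{\,\delta/2-1}\psi\|_2\le b\,\|d_\Gamma^{\,\delta/2}(\nabla\psi)\|_2+c\,\|\psi\|_2$ for all $\psi\in C_c^1(W)$ (with $\inf\emptyset=+\infty$). This applies with $W=\Omega$, $W=\Gamma_r$ and $W=\Gamma_r\cap U$. Set $a_\delta(\Gamma)=\inf_{r>0}a_\delta(\Gamma_r)$, $b_\delta(\Gamma)=\inf_{r>0}b_\delta(\Gamma_r)$ and, for $U\subset\mathbf{R}^d$ bounded and open, $a_\delta(\Gamma\cap U)=\inf_{r>0}a_\delta(\Gamma_r\cap U)$, $b_\delta(\Gamma\cap U)=\inf_{r>0}b_\delta(\Gamma_r\cap U)$. *)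

theory Defs
  imports "HOL-Analysis.Analysis"
begin

definition grad :: "('a::euclidean_space \<Rightarrow> real) \<Rightarrow> 'a \<Rightarrow> 'a" where
  "grad \<psi> x = (THE D. GDERIV \<psi> x :> D)"

text \<open>Real-valued \<open>C\<^sup>1\<close>-functions with compact support in \<open>W\<close>. They are identified
  with their extensions by zero, which are \<open>C\<^sup>1\<close> on the whole space when \<open>W\<close> is open.\<close>

definition Cc1 :: "'a::euclidean_space set \<Rightarrow> ('a \<Rightarrow> real) set" where
  "Cc1 W = {\<psi>. (\<forall>x. \<exists>D. GDERIV \<psi> x :> D) \<and> continuous_on UNIV (grad \<psi>) \<and>
               compact (closure {x. \<psi> x \<noteq> 0}) \<and> closure {x. \<psi> x \<noteq> 0} \<subseteq> W}"

definition bdist :: "'a::euclidean_space set \<Rightarrow> 'a \<Rightarrow> real" where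
  "bdist \<Omega> x = infdist x (frontier \<Omega>)"

definition bdry_layer :: "'a::euclidean_space set \<Rightarrow> real \<Rightarrow> 'a set" where
  "bdry_layer \<Omega> r = {x \<in> \<Omega>. bdist \<Omega> x < r}"

text \<open>The Bochner integral is \<open>0\<close> for non-integrable functions. Below, \<open>L2_norm\<close> is only applied
  to functions which vanish outside a compact subset of the open set \<open>\<Omega>\<close> and are continuous
  on \<open>\<Omega>\<close>, so that the integral is the true one.\<close>

definition L2_norm :: "'a::euclidean_space set \<Rightarrow> ('a \<Rightarrow> 'b::real_normed_vector) \<Rightarrow> real" where
  "L2_norm \<Omega> f = sqrt (LINT x:\<Omega>|lborel. (norm (f x))\<^sup>2)"

definition hardy_lhs :: "'a::euclidean_space set \<Rightarrow> real \<Rightarrow> ('a \<Rightarrow> real) \<Rightarrow> real" where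
  "hardy_lhs \<Omega> \<delta> \<psi> = L2_norm \<Omega> (\<lambda>x. bdist \<Omega> x powr (\<delta>/2 - 1) * \<psi> x)"

definition hardy_rhs :: "'a::euclidean_space set \<Rightarrow> real \<Rightarrow> ('a \<Rightarrow> real) \<Rightarrow> real" where
  "hardy_rhs \<Omega> \<delta> \<psi> = L2_norm \<Omega> (\<lambda>x. bdist \<Omega> x powr (\<delta>/2) *\<^sub>R grad \<psi> x)"

definition hardy_ineq :: "'a::euclidean_space set \<Rightarrow> real \<Rightarrow> 'a set \<Rightarrow> real \<Rightarrow> bool" where
  "hardy_ineq \<Omega> \<delta> W a \<longleftrightarrow> (\<forall>\<psi>\<in>Cc1 W. hardy_lhs \<Omega> \<delta> \<psi> \<le> a * hardy_rhs \<Omega> \<delta> \<psi>)"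

definition weak_hardy_ineq ::
    "'a::euclidean_space set \<Rightarrow> real \<Rightarrow> 'a set \<Rightarrow> real \<Rightarrow> real \<Rightarrow> bool" where
  "weak_hardy_ineq \<Omega> \<delta> W b c \<longleftrightarrow>
     (\<forall>\<psi>\<in>Cc1 W. hardy_lhs \<Omega> \<delta> \<psi> \<le> b * hardy_rhs \<Omega> \<delta> \<psi> + c * L2_norm \<Omega> \<psi>)"

definition boundary_hardy :: "'a::euclidean_space set \<Rightarrow> real \<Rightarrow> bool" where
  "boundary_hardy \<Omega> \<delta> \<longleftrightarrow>
     (\<exists>r\<^sub>0>0. \<forall>r\<in>{0<..<r\<^sub>0}. \<exists>a>0. hardy_ineq \<Omega> \<delta> (bdry_layer \<Omega> r) a)"

definition weak_hardy :: "'a::euclidean_space set \<Rightarrow> real \<Rightarrow> bool" where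
  "weak_hardy \<Omega> \<delta> \<longleftrightarrow> (\<exists>b>0. \<exists>c>0. weak_hardy_ineq \<Omega> \<delta> \<Omega> b c)"

text \<open>Best constants, in the extended reals so that the infimum of the empty set is \<open>\<infinity>\<close>.\<close>

definition a_const :: "'a::euclidean_space set \<Rightarrow> real \<Rightarrow> 'a set \<Rightarrow> ereal" where
  "a_const \<Omega> \<delta> W = Inf (ereal ` {a. a > 0 \<and> hardy_ineq \<Omega> \<delta> W a})"

definition b_const :: "'a::euclidean_space set \<Rightarrow> real \<Rightarrow> 'a set \<Rightarrow> ereal" where
  "b_const \<Omega> \<delta> W = Inf (ereal ` {b. b > 0 \<and> (\<exists>c>0. weak_hardy_ineq \<Omega> \<delta> W b c)})"

text \<open>The constants of \<open>\<Gamma> \<inter> U\<close>; those of \<open>\<Gamma>\<close> itself are obtained for \<open>U = UNIV\<close>.\<close>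

definition a_bdry :: "'a::euclidean_space set \<Rightarrow> real \<Rightarrow> 'a set \<Rightarrow> ereal" where
  "a_bdry \<Omega> \<delta> U = (INF r\<in>{0<..}. a_const \<Omega> \<delta> (bdry_layer \<Omega> r \<inter> U))"

definition b_bdry :: "'a::euclidean_space set \<Rightarrow> real \<Rightarrow> 'a set \<Rightarrow> ereal" where
  "b_bdry \<Omega> \<delta> U = (INF r\<in>{0<..}. b_const \<Omega> \<delta> (bdry_layer \<Omega> r \<inter> U))"

end

theory Submission
  imports Defs
begin

text \<open>A cutoff \<open>\<eta>\<close> equal to \<open>1\<close> near \<open>\<Gamma>\<close> and supported in \<open>\<Gamma>\<^sub>r\<close> turns the Hardy inequality on
  \<open>\<Gamma>\<^sub>r\<close> into a weak one on \<open>\<Omega>\<close> with the same leading constant: the term \<open>\<psi> \<nabla>\<eta>\<close> and the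
  part \<open>(1 - \<eta>) \<psi>\<close> live where \<open>d\<^sub>\<Gamma>\<close> is bounded, respectively bounded away from \<open>0\<close>, and are
  absorbed in \<open>c \<parallel>\<psi>\<parallel>\<close>. Conversely \<open>\<parallel>\<psi>\<parallel> \<le> s\<^bsup>1 - \<delta>/2\<^esup> \<parallel>d\<^sub>\<Gamma>\<^bsup>\<delta>/2 - 1\<^esup> \<psi>\<parallel>\<close> for \<open>\<psi>\<close> supported
  in \<open>\<Gamma>\<^sub>s\<close>, so for small \<open>s\<close> the term \<open>c \<parallel>\<psi>\<parallel>\<close> of a weak inequality is absorbed on the left.
  The cutoff must be \<open>C\<^sup>1\<close> whereas \<open>d\<^sub>\<Gamma>\<close> is only Lipschitz; on the compact support of \<open>\<psi>\<close> the
  distance is therefore replaced by a soft minimum of smoothed distances to finitely many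
  boundary points, whose gradient is a convex combination of vectors of norm at most \<open>1\<close>.\<close>

section \<open>The \<open>L\<^sub>2\<close>-norm\<close>

lemma L2_norm_nonneg: "0 \<le> L2_norm \<Omega> f"
  unfolding L2_norm_def set_lebesgue_integral_def
  by (intro real_sqrt_ge_zero Bochner_Integration.integral_nonneg) auto

lemma L2_norm_sq: "(L2_norm \<Omega> f)\<^sup>2 = (LINT x:\<Omega>|lborel. (norm (f x))\<^sup>2)"
proof -
  have "0 \<le> (LINT x:\<Omega>|lborel. (norm (f x))\<^sup>2)"
    unfolding set_lebesgue_integral_def by (intro Bochner_Integration.integral_nonneg) auto
  then show ?thesis unfolding L2_norm_def by simp
qed

text \<open>Cauchy-Schwarz for two terms; the gap is the square
  \<open>(u * B - v * A)\<^sup>2 / (A * B)\<close>. With \<open>A\<close> and \<open>B\<close> close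
  to the norms of two functions it yields Minkowski's inequality by mere integration.\<close>

lemma sq_add_le_weighted:
  fixes u v A B :: real
  assumes "0 < A" "0 < B"
  shows "(u + v)\<^sup>2 \<le> (A + B) * (u\<^sup>2 / A + v\<^sup>2 / B)"
proof -
  have "(A + B) * (u\<^sup>2 / A + v\<^sup>2 / B) - (u + v)\<^sup>2 = (u * B - v * A)\<^sup>2 / (A * B)"
    using assms by (simp add: field_simps power2_eq_square)
  also have "\<dots> \<ge> 0" using assms by simp
  finally show ?thesis by simp
qed

text \<open>Minkowski's inequality, obtained by integrating \<open>sq_add_le_weighted\<close>
  pointwise. The hypothesis compares norms only, so vector-valued gradients and scalar functions can
  be mixed.\<close>

lemma L2_norm_triangle:
  fixes f :: "'a::euclidean_space \<Rightarrow> 'b::real_normed_vector"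
    and g :: "'a \<Rightarrow> 'c::real_normed_vector" and h :: "'a \<Rightarrow> 'd::real_normed_vector"
  assumes f: "set_integrable lborel \<Omega> (\<lambda>x. (norm (f x))\<^sup>2)"
    and g: "set_integrable lborel \<Omega> (\<lambda>x. (norm (g x))\<^sup>2)"
    and c: "0 \<le> c"
    and h: "\<And>x. x \<in> \<Omega> \<Longrightarrow> norm (h x) \<le> norm (f x) + c * norm (g x)"
  shows "L2_norm \<Omega> h \<le> L2_norm \<Omega> f + c * L2_norm \<Omega> g"
proof (rule field_le_epsilon)
  fix e :: real assume e: "0 < e"
  \<comment> \<open>The extra \<open>e / 2\<close> keeps both weights positive when a norm vanishes,
    so that division by them is safe.\<close>
  define A where "A = L2_norm \<Omega> f + e / 2"
  define B where "B = c * L2_norm \<Omega> g + e / 2"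
  have A: "0 < A" "L2_norm \<Omega> f \<le> A" and B: "0 < B" "c * L2_norm \<Omega> g \<le> B"
    using e c L2_norm_nonneg[of \<Omega> f] mult_nonneg_nonneg[OF c L2_norm_nonneg[of \<Omega> g]]
    by (auto simp: A_def B_def)
  define F where "F x = indicator \<Omega> x *\<^sub>R (norm (f x))\<^sup>2" for x
  define G where "G x = indicator \<Omega> x *\<^sub>R (norm (g x))\<^sup>2" for x
  have LFG: "(L2_norm \<Omega> f)\<^sup>2 = (LINT x|lborel. F x)" "(L2_norm \<Omega> g)\<^sup>2 = (LINT x|lborel. G x)"
    unfolding L2_norm_sq set_lebesgue_integral_def F_def G_def by simp_all
  have FG: "integrable lborel F" "integrable lborel G"
    using f g unfolding set_integrable_def F_def G_def by auto
  have "(L2_norm \<Omega> h)\<^sup>2 = (LINT x|lborel. indicator \<Omega> x *\<^sub>R (norm (h x))\<^sup>2)"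
    unfolding L2_norm_sq set_lebesgue_integral_def by simp
  also have "\<dots> \<le> (LINT x|lborel. (A + B) * (F x / A + c\<^sup>2 * G x / B))"
  \<comment> \<open>Only the majorant has to be integrable: if the left integrand is not, its
    integral is 0 by default, and the majorant is nonnegative.\<close>
  proof (rule integral_mono')
    show "integrable lborel (\<lambda>x. (A + B) * (F x / A + c\<^sup>2 * G x / B))"
      using FG by auto
  next
    fix x :: 'a
    show "0 \<le> (A + B) * (F x / A + c\<^sup>2 * G x / B)"
      using A B by (auto simp: F_def G_def intro!: mult_nonneg_nonneg add_nonneg_nonneg)
    show "indicator \<Omega> x *\<^sub>R (norm (h x))\<^sup>2 \<le> (A + B) * (F x / A + c\<^sup>2 * G x / B)"
    proof (cases "x \<in> \<Omega>")
      case True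
      have "(norm (h x))\<^sup>2 \<le> (norm (f x) + c * norm (g x))\<^sup>2"
        using h[OF True] by (intro power_mono) auto
      also have "\<dots> \<le> (A + B) * ((norm (f x))\<^sup>2 / A + (c * norm (g x))\<^sup>2 / B)"
        using sq_add_le_weighted A B by blast
      finally show ?thesis using True by (simp add: F_def G_def power_mult_distrib)
    next
      case False
      then show ?thesis by (simp add: F_def G_def)
    qed
  qed
  also have "\<dots> = (A + B) * ((L2_norm \<Omega> f)\<^sup>2 / A + (c * L2_norm \<Omega> g)\<^sup>2 / B)"
    using FG by (simp add: power_mult_distrib LFG)
  also have "\<dots> \<le> (A + B) * (A\<^sup>2 / A + B\<^sup>2 / B)"
    using A B c L2_norm_nonneg[of \<Omega> f] L2_norm_nonneg[of \<Omega> g]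
    by (intro mult_left_mono add_mono divide_right_mono power_mono) auto
  also have "\<dots> = (A + B)\<^sup>2"
    using A B by (simp add: power2_eq_square)
  finally have "L2_norm \<Omega> h \<le> A + B"
    by (rule power2_le_imp_le) (use A B in auto)
  then show "L2_norm \<Omega> h \<le> L2_norm \<Omega> f + c * L2_norm \<Omega> g + e"
    by (simp add: A_def B_def)
qed

lemma L2_norm_mono:
  fixes g :: "'a::euclidean_space \<Rightarrow> 'c::real_normed_vector"
    and h :: "'a \<Rightarrow> 'd::real_normed_vector"
  assumes "set_integrable lborel \<Omega> (\<lambda>x. (norm (g x))\<^sup>2)" and "0 \<le> c"
    and "\<And>x. x \<in> \<Omega> \<Longrightarrow> norm (h x) \<le> c * norm (g x)"
  shows "L2_norm \<Omega> h \<le> c * L2_norm \<Omega> g"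
proof -
  have "L2_norm \<Omega> h \<le> L2_norm \<Omega> (\<lambda>x. 0 :: real) + c * L2_norm \<Omega> g"
    by (rule L2_norm_triangle) (use assms in \<open>auto simp: set_integrable_def\<close>)
  then show ?thesis by (simp add: L2_norm_def set_lebesgue_integral_def)
qed

text \<open>Since \<open>f\<close> vanishes on \<open>\<Omega>\<close> outside \<open>K\<close>, the
  integrand on \<open>\<Omega>\<close> agrees with its restriction to \<open>K\<close>, which is
  continuous on a compact set.\<close>

lemma set_integrable_norm_sq:
  fixes f :: "'a::euclidean_space \<Rightarrow> 'b::real_normed_vector"
  assumes "compact K" "K \<subseteq> \<Omega>" "continuous_on \<Omega> f"
    and "\<And>x. x \<in> \<Omega> \<Longrightarrow> x \<notin> K \<Longrightarrow> f x = 0"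
  shows "set_integrable lborel \<Omega> (\<lambda>x. (norm (f x))\<^sup>2)"
proof -
  have "continuous_on K (\<lambda>x. (norm (f x))\<^sup>2)"
    using assms(2,3) by (intro continuous_intros) (rule continuous_on_subset)
  then have "integrable lborel (\<lambda>x. indicator K x *\<^sub>R (norm (f x))\<^sup>2)"
    by (rule borel_integrable_compact[OF assms(1)])
  also have "(\<lambda>x. indicator K x *\<^sub>R (norm (f x))\<^sup>2) = (\<lambda>x. indicator \<Omega> x *\<^sub>R (norm (f x))\<^sup>2)"
    using assms(2,4) by (auto simp: indicator_def fun_eq_iff)
  finally show ?thesis unfolding set_integrable_def .
qed

section \<open>Gradients and compactly supported functions\<close>

lemma GDERIV_unique:
  fixes f :: "'a::euclidean_space \<Rightarrow> real"
  assumes "GDERIV f x :> D" "GDERIV f x :> E"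
  shows "D = E"
proof -
  have "(\<lambda>h. inner h D) = (\<lambda>h. inner h E)"
    using assms unfolding gderiv_def by (rule has_derivative_unique)
  then have "inner (D - E) (D - E) = 0"
    by (metis inner_diff_right diff_self)
  then show ?thesis by simp
qed

lemma grad_eq: "GDERIV f x :> D \<Longrightarrow> grad f x = D"
  unfolding grad_def using GDERIV_unique by blast

lemma Cc1_mono: "V \<subseteq> W \<Longrightarrow> Cc1 V \<subseteq> Cc1 W"
  unfolding Cc1_def by auto

lemma Cc1_GDERIV:
  assumes "\<psi> \<in> Cc1 W"
  shows "GDERIV \<psi> x :> grad \<psi> x"
proof -
  obtain D where "GDERIV \<psi> x :> D" using assms unfolding Cc1_def by auto
  then show ?thesis using grad_eq by metis
qed

lemma GDERIV_continuous_on: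
  assumes "\<And>x. GDERIV f x :> f' x"
  shows "continuous_on S f"
proof (intro continuous_at_imp_continuous_on ballI)
  show "isCont f x" for x
    using assms[of x] unfolding gderiv_def by (rule has_derivative_continuous)
qed

lemma Cc1_continuous_on: "\<psi> \<in> Cc1 W \<Longrightarrow> continuous_on S \<psi>"
  by (rule GDERIV_continuous_on, rule Cc1_GDERIV)

lemma Cc1_continuous_on_grad:
  assumes "\<psi> \<in> Cc1 W"
  shows "continuous_on S (grad \<psi>)"
proof (rule continuous_on_subset[OF _ subset_UNIV])
  show "continuous_on UNIV (grad \<psi>)" using assms unfolding Cc1_def by blast
qed

lemma Cc1_zero:
  assumes "\<psi> \<in> Cc1 W" "x \<notin> closure {x. \<psi> x \<noteq> 0}"
  shows "\<psi> x = 0" "grad \<psi> x = 0"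
proof -
  let ?K = "closure {x. \<psi> x \<noteq> 0}"
  have z: "\<psi> y = 0" if "y \<in> - ?K" for y
    using that closure_subset[of "{x. \<psi> x \<noteq> 0}"] by auto
  show "\<psi> x = 0" by (rule z) (use assms(2) in blast)
  \<comment> \<open>The complement of the support is open, so \<open>\<psi>\<close> coincides with 0
    near \<open>x\<close> and inherits the derivative 0.\<close>
  have "((\<lambda>x. 0) has_derivative (\<lambda>h. 0)) (at x)" by simp
  then have "(\<psi> has_derivative (\<lambda>h. 0)) (at x)"
  proof (rule has_derivative_transform_within_open)
    show "open (- ?K)" by (rule open_Compl[OF closed_closure])
    show "x \<in> - ?K" using assms(2) by blast
    show "0 = \<psi> y" if "y \<in> - ?K" for y using z[OF that] by (rule sym)
  qed
  then have "GDERIV \<psi> x :> 0" unfolding gderiv_def by simp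
  then show "grad \<psi> x = 0" by (rule grad_eq)
qed

lemma Cc1_I:
  assumes "\<And>x. GDERIV \<psi> x :> D x" and "continuous_on UNIV D"
    and "compact K" "K \<subseteq> W" "\<And>x. \<psi> x \<noteq> 0 \<Longrightarrow> x \<in> K"
  shows "\<psi> \<in> Cc1 W"
proof -
  have "grad \<psi> = D" using assms(1) grad_eq by blast
  moreover have sub: "closure {x. \<psi> x \<noteq> 0} \<subseteq> K"
    using assms(3,5) by (intro closure_minimal) (auto simp: compact_imp_closed)
  moreover have "compact (closure {x. \<psi> x \<noteq> 0})"
    using sub assms(3) by (meson closed_closure compact_closure bounded_subset
        compact_imp_bounded closure_subset order_trans)
  ultimately show ?thesis using assms unfolding Cc1_def by blast
qed

section \<open>Smooth cutoffs adapted to the distance\<close>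

text \<open>For each \<open>p\<close> in \<open>S\<close> the set of points to which
  \<open>p\<close> is almost nearest is open, and these sets cover \<open>K\<close>; the centres of
  a finite subcover form the net.\<close>

lemma finite_net_infdist:
  fixes S :: "'a::metric_space set"
  assumes "compact K" "S \<noteq> {}" "0 < e"
  obtains P where "finite P" "P \<noteq> {}" "P \<subseteq> S" "\<And>x. x \<in> K \<Longrightarrow> \<exists>p\<in>P. dist x p < infdist x S + e"
proof -
  have opn: "open {x. dist x p < infdist x S + e}" for p
    by (intro open_Collect_less continuous_intros)
  have cov: "K \<subseteq> (\<Union>p\<in>S. {x. dist x p < infdist x S + e})"
  proof
    fix x assume "x \<in> K"
    have "(INF a\<in>S. dist x a) < infdist x S + e"
      using assms by (simp add: infdist_notempty)
    then have "\<exists>a\<in>S. dist x a < infdist x S + e"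
      by (subst (asm) cINF_less_iff) (use assms in auto)
    then show "x \<in> (\<Union>p\<in>S. {x. dist x p < infdist x S + e})" by auto
  qed
  obtain C where C: "C \<subseteq> S" "finite C" "K \<subseteq> (\<Union>p\<in>C. {x. dist x p < infdist x S + e})"
    using compactE_image[OF assms(1) opn cov] by blast
  \<comment> \<open>An additional point keeps the net nonempty even when \<open>K\<close> is
    empty.\<close>
  obtain q where q: "q \<in> S" using assms by auto
  show ?thesis
    by (rule that[of "insert q C"]) (use C q in auto)
qed

section \<open>Smooth approximation of the distance to a set\<close>

lemma GDERIV_smoothed_dist:
  fixes p :: "'a::euclidean_space"
  assumes "0 < e"
  shows "GDERIV (\<lambda>y. sqrt (inner (y - p) (y - p) + e\<^sup>2)) x
    :> (1 / sqrt (inner (x - p) (x - p) + e\<^sup>2)) *\<^sub>R (x - p)"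
proof -
  have pos: "0 < inner (x - p) (x - p) + e\<^sup>2" using assms by (intro add_nonneg_pos) auto
  have d: "((\<lambda>y. y - p) has_derivative (\<lambda>v. v)) (at x)"
    by (auto intro!: derivative_eq_intros)
  have "((\<lambda>y. inner (y - p) (y - p)) has_derivative (\<lambda>v. inner v (2 *\<^sub>R (x - p)))) (at x)"
    by (rule has_derivative_eq_rhs[OF has_derivative_inner[OF d d]])
      (simp add: inner_commute[of "x - p"] fun_eq_iff)
  then have "GDERIV (\<lambda>y. inner (y - p) (y - p) + e\<^sup>2) x :> 2 *\<^sub>R (x - p) + 0"
    by (intro GDERIV_add GDERIV_const) (simp only: gderiv_def)
  note D = GDERIV_DERIV_compose[OF this DERIV_real_sqrt[OF pos]]
  have "inverse t / 2 * 2 = 1 / t" for t :: real by (simp add: inverse_eq_divide)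
  then show ?thesis
    by (intro GDERIV_subst[OF D]) (simp only: add_0_right scaleR_scaleR)
qed

text \<open>In the logarithm of a sum of exponentials the factor \<open>\<beta>\<close> cancels by
  the chain rule. What remains is an average of the \<open>H p\<close> with positive weights of sum
  1, so a common bound on their norms survives.\<close>

lemma GDERIV_soft_min:
  fixes h :: "'i \<Rightarrow> 'a::euclidean_space \<Rightarrow> real"
  assumes P: "finite P" "P \<noteq> {}" and \<beta>: "0 < \<beta>" and h: "\<And>p. GDERIV (h p) x :> H p"
  shows "GDERIV (\<lambda>x. - (ln (\<Sum>p\<in>P. exp (- \<beta> * h p x)) / \<beta>)) x
    :> (1 / (\<Sum>p\<in>P. exp (- \<beta> * h p x))) *\<^sub>R (\<Sum>p\<in>P. exp (- \<beta> * h p x) *\<^sub>R H p)"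
proof -
  have pos: "0 < (\<Sum>p\<in>P. exp (- \<beta> * h p x))" using P by (intro sum_pos) auto
  have w: "GDERIV (\<lambda>x. exp (- \<beta> * h p x)) x :> (exp (- \<beta> * h p x) * - \<beta>) *\<^sub>R H p" for p
  proof (rule GDERIV_DERIV_compose[OF h])
    show "((\<lambda>t. exp (- \<beta> * t)) has_real_derivative exp (- \<beta> * h p x) * - \<beta>) (at (h p x))"
      by (auto intro!: derivative_eq_intros)
  qed
  have F: "GDERIV (\<lambda>x. \<Sum>p\<in>P. exp (- \<beta> * h p x)) x
      :> (\<Sum>p\<in>P. (exp (- \<beta> * h p x) * - \<beta>) *\<^sub>R H p)"
    using w unfolding gderiv_def inner_sum_right by (intro has_derivative_sum) auto
  have l: "((\<lambda>t. - (ln t / \<beta>)) has_real_derivative - (1 / (t * \<beta>))) (at t)" if "0 < t" for t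
    using that \<beta> by (auto intro!: derivative_eq_intros)
  from GDERIV_DERIV_compose[OF F l[OF pos]] show ?thesis
    by (rule GDERIV_subst) (use \<beta> in \<open>simp add: scaleR_sum_right\<close>)
qed

text \<open>Every smoothed distance is at least the distance to \<open>S\<close>, so from below only
  the logarithm of the number of net points is lost; from above, the net and the smoothing cost
  \<open>e/2\<close> each. The gradient bound 1 is independent of \<open>K\<close> and
  \<open>e\<close>.\<close>

lemma smooth_infdist_approx:
  fixes S :: "'a::euclidean_space set"
  assumes K: "compact K" and S: "S \<noteq> {}" and e: "0 < e"
  obtains g G where "\<And>x. GDERIV g x :> G x" "continuous_on UNIV G" "\<And>x. norm (G x) \<le> 1"
    "\<And>x. x \<in> K \<Longrightarrow> \<bar>g x - infdist x S\<bar> \<le> e"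
proof -
  obtain P where P: "finite P" "P \<noteq> {}" "P \<subseteq> S"
    and net: "\<And>x. x \<in> K \<Longrightarrow> \<exists>p\<in>P. dist x p < infdist x S + e/2"
    using finite_net_infdist[OF K S, of "e/2"] e by auto
  \<comment> \<open>Unlike \<open>dist x p\<close>, this is differentiable at \<open>p\<close> as
    well, and it exceeds the distance by at most \<open>e/2\<close>.\<close>
  define h where "h p x = sqrt (inner (x - p) (x - p) + (e/2)\<^sup>2)" for p x :: 'a
  have pos: "0 < inner (x - p) (x - p) + (e/2)\<^sup>2" for x p :: 'a
    using e by (intro add_nonneg_pos) auto
  have hpos: "0 < h p x" for p x unfolding h_def using pos by simp
  have h_ge: "dist x p \<le> h p x" for p x
    unfolding h_def dist_norm norm_eq_sqrt_inner by simp
  have h_le: "h p x \<le> dist x p + e/2" for p x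
    using sqrt_add_le_add_sqrt[of "inner (x - p) (x - p)" "(e/2)\<^sup>2"] e
    unfolding h_def dist_norm norm_eq_sqrt_inner by simp
  define N where "N = real (card P)"
  have N: "1 \<le> N" unfolding N_def using P by (simp add: Suc_leI card_gt_0_iff)
  \<comment> \<open>The soft minimum lies below the true minimum by at most
    \<open>ln N / \<beta>\<close>; as \<open>ln N \<le> N\<close>, this \<open>\<beta>\<close> keeps
    the loss within \<open>e\<close>.\<close>
  define \<beta> where "\<beta> = N / e"
  have \<beta>: "0 < \<beta>" unfolding \<beta>_def using N e by simp
  define w where "w p x = exp (- \<beta> * h p x)" for p x
  define F where "F x = (\<Sum>p\<in>P. w p x)" for x
  have Fpos: "0 < F x" for x
    unfolding F_def w_def using P by (intro sum_pos) auto
  define g where "g x = - (ln (F x) / \<beta>)" for x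
  define G where "G x = (1 / F x) *\<^sub>R (\<Sum>p\<in>P. w p x *\<^sub>R ((1 / h p x) *\<^sub>R (x - p)))" for x
  have "GDERIV g x :> G x" for x
  proof -
    have "GDERIV (h p) x :> (1 / h p x) *\<^sub>R (x - p)" for p
      unfolding h_def using e by (intro GDERIV_smoothed_dist) simp
    then show ?thesis
      unfolding g_def G_def F_def w_def by (intro GDERIV_soft_min P \<beta>)
  qed
  moreover have "continuous_on UNIV G"
  proof -
    have ch: "continuous_on UNIV (h p)" for p
      unfolding h_def by (intro continuous_intros)
    then have cw: "continuous_on UNIV (w p)" for p
      unfolding w_def by (intro continuous_intros)
    then have "continuous_on UNIV F"
      unfolding F_def by (intro continuous_intros)
    then show ?thesis
      unfolding G_def using Fpos hpos cw ch
      by (intro continuous_intros) (auto simp: less_le)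
  qed
  moreover have "norm (G x) \<le> 1" for x
  proof -
    have "norm (\<Sum>p\<in>P. w p x *\<^sub>R ((1 / h p x) *\<^sub>R (x - p))) \<le> (\<Sum>p\<in>P. w p x)"
    proof (rule sum_norm_le)
      fix p
      have "norm ((1 / h p x) *\<^sub>R (x - p)) \<le> 1"
        using hpos[of p x] h_ge[of x p] by (simp add: dist_norm)
      then have "w p x * norm ((1 / h p x) *\<^sub>R (x - p)) \<le> w p x * 1"
        by (intro mult_left_mono) (auto simp: w_def)
      then show "norm (w p x *\<^sub>R ((1 / h p x) *\<^sub>R (x - p))) \<le> w p x"
        by (simp add: w_def)
    qed
    then show ?thesis unfolding G_def using Fpos[of x] by (simp add: F_def[symmetric])
  qed
  moreover have "\<bar>g x - infdist x S\<bar> \<le> e" if xK: "x \<in> K" for x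
  proof -
    let ?d = "infdist x S"
    have "F x \<le> (\<Sum>p\<in>P. exp (- \<beta> * ?d))"
      unfolding F_def w_def
    proof (intro sum_mono)
      fix p assume "p \<in> P"
      then have "?d \<le> h p x"
        using infdist_le[of p S x] h_ge[of x p] P by auto
      then show "exp (- \<beta> * h p x) \<le> exp (- \<beta> * ?d)" using \<beta> by simp
    qed
    then have "ln (F x) \<le> ln (N * exp (- \<beta> * ?d))"
      using Fpos N by (simp add: N_def)
    also have "\<dots> = ln N - \<beta> * ?d" using N by (simp add: ln_mult)
    also have "\<dots> \<le> N - \<beta> * ?d" using N ln_le_minus_one[of N] by simp
    finally have lower: "?d - e \<le> g x"
      unfolding g_def using \<beta> e by (simp add: \<beta>_def field_simps)
    \<comment> \<open>For the upper bound a single term of the sum suffices, that of a net point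
      almost nearest to \<open>x\<close>.\<close>
    obtain p where p: "p \<in> P" "dist x p < ?d + e/2" using net[OF xK] by auto
    have "exp (- \<beta> * (?d + e)) \<le> w p x"
      unfolding w_def using h_le[of p x] p \<beta> by simp
    also have "\<dots> \<le> F x"
      unfolding F_def by (rule member_le_sum) (use p P in \<open>auto simp: w_def\<close>)
    finally have "- \<beta> * (?d + e) \<le> ln (F x)"
      using Fpos[of x] by (simp add: ln_ge_iff)
    then have "g x \<le> ?d + e" unfolding g_def using \<beta> by (simp add: field_simps)
    with lower show ?thesis by linarith
  qed
  ultimately show ?thesis using that by blast
qed

section \<open>Cutoff functions\<close>

lemma DERIV_pos_part_sq: "((\<lambda>t. (max 0 t)\<^sup>2) has_real_derivative 2 * max 0 t) (at t)"
  for t :: real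
proof -
  \<comment> \<open>The error of the linear expansion is quadratic, also across the kink of
    \<open>max 0\<close> at 0; dividing by \<open>y - t\<close> leaves at most
    \<open>\<bar>y - t\<bar>\<close>.\<close>
  have "\<bar>(max 0 y)\<^sup>2 - (max 0 t)\<^sup>2 - 2 * max 0 t * (y - t)\<bar> \<le> (y - t)\<^sup>2" for y
  proof -
    consider "0 \<le> t" "0 \<le> y" | "0 \<le> t" "y < 0" | "t < 0" "0 \<le> y" | "t < 0" "y < 0" by linarith
    then show ?thesis
    proof cases
      case 1
      have "y\<^sup>2 - t\<^sup>2 - 2 * t * (y - t) = (y - t)\<^sup>2" by (simp add: power2_eq_square algebra_simps)
      then show ?thesis using 1 by simp
    next
      case 2
      have "t * y \<le> 0" using 2 by (simp add: mult_nonneg_nonpos)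
      then have "0 \<le> t\<^sup>2 - 2 * (t * y)" using zero_le_power2[of t] by linarith
      moreover have eq: "0\<^sup>2 - t\<^sup>2 - 2 * t * (y - t) = t\<^sup>2 - 2 * (t * y)"
        "(y - t)\<^sup>2 = t\<^sup>2 - 2 * (t * y) + y\<^sup>2"
        by (simp_all add: power2_eq_square algebra_simps)
      ultimately have "\<bar>0\<^sup>2 - t\<^sup>2 - 2 * t * (y - t)\<bar> \<le> (y - t)\<^sup>2"
        unfolding eq by simp
      then show ?thesis using 2 by simp
    next
      case 3
      then have "y\<^sup>2 \<le> (y - t)\<^sup>2" by (intro power_mono) auto
      then show ?thesis using 3 by simp
    qed auto
  qed
  note bound = this
  have "((\<lambda>y. ((max 0 y)\<^sup>2 - (max 0 t)\<^sup>2) / (y - t) - 2 * max 0 t) \<longlongrightarrow> 0) (at t)"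
  proof (rule Lim_null_comparison)
    show "\<forall>\<^sub>F y in at t. norm (((max 0 y)\<^sup>2 - (max 0 t)\<^sup>2) / (y - t) - 2 * max 0 t) \<le> \<bar>y - t\<bar>"
    proof (rule eventually_at_topological[THEN iffD2], intro exI[of _ UNIV] conjI ballI impI)
      fix y assume "y \<noteq> t"
      then have "((max 0 y)\<^sup>2 - (max 0 t)\<^sup>2) / (y - t) - 2 * max 0 t
          = ((max 0 y)\<^sup>2 - (max 0 t)\<^sup>2 - 2 * max 0 t * (y - t)) / (y - t)"
        by (simp add: diff_divide_distrib)
      moreover have "(y - t)\<^sup>2 = \<bar>y - t\<bar> * \<bar>y - t\<bar>" by (simp add: power2_eq_square)
      ultimately show "norm (((max 0 y)\<^sup>2 - (max 0 t)\<^sup>2) / (y - t) - 2 * max 0 t) \<le> \<bar>y - t\<bar>"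
        using bound[of y] \<open>y \<noteq> t\<close> by (simp add: pos_divide_le_eq)
    qed auto
    show "((\<lambda>y. \<bar>y - t\<bar>) \<longlongrightarrow> 0) (at t)"
      by (rule tendsto_eq_intros refl | simp)+
  qed
  then show ?thesis
    unfolding has_field_derivative_iff using Lim_null by blast
qed

lemma C1_step:
  obtains \<sigma> \<sigma>' :: "real \<Rightarrow> real" where
    "\<And>t. (\<sigma> has_real_derivative \<sigma>' t) (at t)" "continuous_on UNIV \<sigma>'"
    "\<And>t. 0 \<le> \<sigma> t" "\<And>t. \<sigma> t \<le> 1" "\<And>t. t \<le> 0 \<Longrightarrow> \<sigma> t = 1" "\<And>t. 1 \<le> t \<Longrightarrow> \<sigma> t = 0"
    "\<And>t. \<bar>\<sigma>' t\<bar> \<le> 2" "\<And>t. 1 \<le> t \<Longrightarrow> \<sigma>' t = 0"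
proof -
  \<comment> \<open>quadratic spline whose derivative is minus the hat function on \<open>{0..1}\<close> of height 2\<close>
  define \<sigma> :: "real \<Rightarrow> real" where
    "\<sigma> t = 1 - (2 * (max 0 t)\<^sup>2 - 4 * (max 0 (t - 1/2))\<^sup>2 + 2 * (max 0 (t - 1))\<^sup>2)" for t
  define \<sigma>' :: "real \<Rightarrow> real" where
    "\<sigma>' t = - (4 * max 0 t - 8 * max 0 (t - 1/2) + 4 * max 0 (t - 1))" for t
  have D: "((\<lambda>t. (max 0 (t - k))\<^sup>2) has_real_derivative 2 * max 0 (t - k)) (at t)" for t k :: real
  proof -
    have "((\<lambda>t. t - k) has_real_derivative 1) (at t)" by (auto intro!: derivative_eq_intros)
    from DERIV_chain2[OF DERIV_pos_part_sq this] show ?thesis by simp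
  qed
  have "(\<sigma> has_real_derivative \<sigma>' t) (at t)" for t
    unfolding \<sigma>_def \<sigma>'_def
    by (rule derivative_eq_intros DERIV_pos_part_sq D refl)+ simp
  moreover have "continuous_on UNIV \<sigma>'"
    unfolding \<sigma>'_def by (intro continuous_intros)
  moreover have one: "\<sigma> t = 1" if "t \<le> 0" for t using that by (simp add: \<sigma>_def)
  moreover have zero: "\<sigma> t = 0" if "1 \<le> t" for t
    using that by (simp add: \<sigma>_def max_def power2_eq_square field_simps)
  moreover have mid: "0 \<le> \<sigma> t \<and> \<sigma> t \<le> 1" if "0 < t" "t < 1" for t
  proof (cases "t \<le> 1/2")
    case True
    then have "t\<^sup>2 \<le> (1/2)\<^sup>2" using that by (intro power_mono) auto
    moreover have "max 0 t = t" "max 0 (t - 1/2) = 0" "max 0 (t - 1) = 0" using that True by auto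
    then have "\<sigma> t = 1 - 2 * t\<^sup>2" by (simp add: \<sigma>_def)
    ultimately show ?thesis by (simp add: power2_eq_square)
  next
    case False
    then have "\<sigma> t = 2 * (1 - t)\<^sup>2"
      using that by (simp add: \<sigma>_def max_def power2_eq_square field_simps)
    moreover have "(1 - t)\<^sup>2 \<le> (1/2)\<^sup>2" using that False by (intro power_mono) auto
    ultimately show ?thesis by (simp add: power2_eq_square)
  qed
  moreover have "0 \<le> \<sigma> t" for t
    using one[of t] zero[of t] mid[of t] by linarith
  moreover have "\<sigma> t \<le> 1" for t
    using one[of t] zero[of t] mid[of t] by linarith
  moreover have "\<bar>\<sigma>' t\<bar> \<le> 2" for t unfolding \<sigma>'_def max_def by auto
  moreover have "\<sigma>' t = 0" if "1 \<le> t" for t using that by (simp add: \<sigma>'_def)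
  ultimately show ?thesis using that by blast
qed

text \<open>A step function composed with the smoothed distance. The cutoff itself depends on
  \<open>K\<close>, but the gradient bound \<open>4 / r\<close> does not; this lets \<open>K\<close>
  later be the support of an individual function while the constants stay uniform.\<close>

lemma cutoff_infdist:
  fixes S :: "'a::euclidean_space set"
  assumes K: "compact K" and S: "S \<noteq> {}" and r: "0 < r"
  obtains \<eta> X where "\<And>x. GDERIV \<eta> x :> X x" "continuous_on UNIV X"
    "\<And>x. 0 \<le> \<eta> x" "\<And>x. \<eta> x \<le> 1" "\<And>x. norm (X x) \<le> 4 / r"
    "\<And>x. x \<in> K \<Longrightarrow> infdist x S < r/8 \<Longrightarrow> \<eta> x = 1"
    "\<And>x. x \<in> K \<Longrightarrow> 7*r/8 < infdist x S \<Longrightarrow> \<eta> x = 0 \<and> X x = 0"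
proof -
  obtain g G where g: "\<And>x. GDERIV g x :> G x" "continuous_on UNIV G" "\<And>x. norm (G x) \<le> 1"
    and gd: "\<And>x. x \<in> K \<Longrightarrow> \<bar>g x - infdist x S\<bar> \<le> r/8"
    using smooth_infdist_approx[OF K S, of "r/8"] r by auto
  obtain \<sigma> \<sigma>' :: "real \<Rightarrow> real" where
    \<sigma>: "\<And>t. (\<sigma> has_real_derivative \<sigma>' t) (at t)" "continuous_on UNIV \<sigma>'"
    "\<And>t. 0 \<le> \<sigma> t" "\<And>t. \<sigma> t \<le> 1" "\<And>t. t \<le> 0 \<Longrightarrow> \<sigma> t = 1" "\<And>t. 1 \<le> t \<Longrightarrow> \<sigma> t = 0"
    "\<And>t. \<bar>\<sigma>' t\<bar> \<le> 2" "\<And>t. 1 \<le> t \<Longrightarrow> \<sigma>' t = 0"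
    using C1_step by blast
  \<comment> \<open>The affine map taking \<open>r/4\<close> to 0 and \<open>3*r/4\<close> to 1. The
    approximation error \<open>r/8\<close> turns these thresholds for \<open>g\<close> into
    \<open>r/8\<close> and \<open>7*r/8\<close> for the distance.\<close>
  define s where "s t = (t - r/4) * (2/r)" for t
  define \<eta> where "\<eta> x = \<sigma> (s (g x))" for x
  define X where "X x = (\<sigma>' (s (g x)) * (2/r)) *\<^sub>R G x" for x
  have "(s has_real_derivative 2/r) (at t)" for t
    unfolding s_def using r by (auto intro!: derivative_eq_intros)
  then have "((\<lambda>t. \<sigma> (s t)) has_real_derivative \<sigma>' (s t) * (2/r)) (at t)" for t
    by (rule DERIV_chain2[OF \<sigma>(1)])
  then have "GDERIV \<eta> x :> X x" for x
    unfolding \<eta>_def X_def by (rule GDERIV_DERIV_compose[OF g(1)])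
  moreover have "continuous_on UNIV X"
  proof -
    have "continuous_on UNIV (\<lambda>x. s (g x))"
      unfolding s_def using r by (intro continuous_intros GDERIV_continuous_on[OF g(1)])
    then have "continuous_on UNIV (\<lambda>x. \<sigma>' (s (g x)))"
      by (rule continuous_on_compose2[OF \<sigma>(2)]) auto
    then show ?thesis unfolding X_def using g(2) by (intro continuous_intros)
  qed
  moreover have "norm (X x) \<le> 4 / r" for x
  proof -
    have "norm (X x) = (\<bar>\<sigma>' (s (g x))\<bar> * (2/r)) * norm (G x)"
      unfolding X_def using r by (simp add: abs_mult)
    also have "\<dots> \<le> (2 * (2/r)) * 1"
      using r by (intro mult_mono \<sigma> g) auto
    finally show ?thesis by simp
  qed
  moreover have "\<eta> x = 1" if "x \<in> K" "infdist x S < r/8" for x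
  proof -
    have "g x \<le> r/4" using gd[OF that(1)] that(2) by linarith
    then have "s (g x) \<le> 0" using r unfolding s_def by (intro mult_nonpos_nonneg) auto
    then show ?thesis unfolding \<eta>_def by (rule \<sigma>(5))
  qed
  moreover have "\<eta> x = 0 \<and> X x = 0" if "x \<in> K" "7*r/8 < infdist x S" for x
  proof -
    have "3*r/4 \<le> g x" using gd[OF that(1)] that(2) by linarith
    then have "1 \<le> s (g x)" using r unfolding s_def by (simp add: field_simps)
    then show ?thesis unfolding \<eta>_def X_def using \<sigma>(6,8) by simp
  qed
  ultimately show ?thesis using that[of \<eta> X] \<sigma>(3,4) unfolding \<eta>_def by blast
qed

section \<open>Hardy inequalities\<close>

lemma bdist_pos:
  assumes "open \<Omega>" "frontier \<Omega> \<noteq> {}" "x \<in> \<Omega>"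
  shows "0 < bdist \<Omega> x"
proof -
  have "x \<notin> frontier \<Omega>" using assms by (simp add: frontier_def interior_open)
  then show ?thesis
    unfolding bdist_def using assms by (intro infdist_pos_not_in_closed) auto
qed

lemma continuous_on_bdist_powr:
  assumes "open \<Omega>" "frontier \<Omega> \<noteq> {}"
  shows "continuous_on \<Omega> (\<lambda>x. bdist \<Omega> x powr p)"
proof (rule continuous_on_powr)
  show "continuous_on \<Omega> (bdist \<Omega>)" unfolding bdist_def by (intro continuous_intros)
  show "\<forall>x\<in>\<Omega>. bdist \<Omega> x \<noteq> 0" using bdist_pos[OF assms] by force
qed (rule continuous_on_const)

lemma Cc1_set_integrable:
  assumes "open \<Omega>" "frontier \<Omega> \<noteq> {}" "\<psi> \<in> Cc1 W" "W \<subseteq> \<Omega>"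
  shows "set_integrable lborel \<Omega> (\<lambda>x. (norm (\<psi> x))\<^sup>2)"
    and "set_integrable lborel \<Omega> (\<lambda>x. (norm (bdist \<Omega> x powr p * \<psi> x))\<^sup>2)"
    and "set_integrable lborel \<Omega> (\<lambda>x. (norm (bdist \<Omega> x powr p *\<^sub>R grad \<psi> x))\<^sup>2)"
proof -
  have K: "compact (closure {x. \<psi> x \<noteq> 0})" "closure {x. \<psi> x \<noteq> 0} \<subseteq> \<Omega>"
    using assms(3,4) unfolding Cc1_def by auto
  note cont = Cc1_continuous_on[OF assms(3)] Cc1_continuous_on_grad[OF assms(3)]
    continuous_on_bdist_powr[OF assms(1,2)]
  note zero = Cc1_zero[OF assms(3)]
  show "set_integrable lborel \<Omega> (\<lambda>x. (norm (\<psi> x))\<^sup>2)"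
    by (rule set_integrable_norm_sq[OF K cont(1)]) (rule zero)
  show "set_integrable lborel \<Omega> (\<lambda>x. (norm (bdist \<Omega> x powr p * \<psi> x))\<^sup>2)"
    by (rule set_integrable_norm_sq[OF K continuous_on_mult[OF cont(3,1)]]) (drule zero(1), simp)
  show "set_integrable lborel \<Omega> (\<lambda>x. (norm (bdist \<Omega> x powr p *\<^sub>R grad \<psi> x))\<^sup>2)"
    by (rule set_integrable_norm_sq[OF K continuous_on_scaleR[OF cont(3,2)]]) (drule zero(2), simp)
qed

section \<open>Passing between boundary layers and the domain\<close>

lemma bdry_layer_subset: "bdry_layer \<Omega> r \<subseteq> \<Omega>"
  unfolding bdry_layer_def by auto

lemma weak_hardy_ineq_mono:
  "weak_hardy_ineq \<Omega> \<delta> W b c \<Longrightarrow> V \<subseteq> W \<Longrightarrow> weak_hardy_ineq \<Omega> \<delta> V b c"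
  unfolding weak_hardy_ineq_def using Cc1_mono by blast

lemma hardy_imp_weak_hardy_ineq:
  fixes \<Omega> :: "'a::euclidean_space set"
  assumes "hardy_ineq \<Omega> \<delta> W a" "0 \<le> c"
  shows "weak_hardy_ineq \<Omega> \<delta> W a c"
  unfolding weak_hardy_ineq_def
proof
  fix \<psi> assume "\<psi> \<in> Cc1 W"
  then have "hardy_lhs \<Omega> \<delta> \<psi> \<le> a * hardy_rhs \<Omega> \<delta> \<psi>"
    using assms unfolding hardy_ineq_def by blast
  moreover have "0 \<le> c * L2_norm \<Omega> \<psi>"
    using assms(2) L2_norm_nonneg by (rule mult_nonneg_nonneg)
  ultimately show "hardy_lhs \<Omega> \<delta> \<psi> \<le> a * hardy_rhs \<Omega> \<delta> \<psi> + c * L2_norm \<Omega> \<psi>" by linarith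
qed

text \<open>The function \<open>\<eta> \<psi>\<close> lives in the layer and obeys the Hardy
  inequality there. The cutoff is built anew from the support of each \<open>\<psi>\<close>, yet the
  resulting \<open>c = a * c2 + c1\<close> depends only on \<open>a\<close>, \<open>r\<close> and
  \<open>\<delta>\<close>.\<close>

lemma hardy_layer_imp_weak_hardy:
  fixes \<Omega> :: "'a::euclidean_space set"
  assumes \<Omega>: "open \<Omega>" "frontier \<Omega> \<noteq> {}" and \<delta>: "0 \<le> \<delta>" "\<delta> < 2" and r: "0 < r" and a: "0 \<le> a"
    and hardy: "hardy_ineq \<Omega> \<delta> (bdry_layer \<Omega> r) a"
  shows "\<exists>c>0. weak_hardy_ineq \<Omega> \<delta> \<Omega> a c"
proof -
  \<comment> \<open>\<open>c1\<close> bounds the weight of the left side where the distance is at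
    least \<open>r/8\<close>, its exponent being negative; \<open>c2\<close> bounds the weight of
    the right side times the norm of the gradient of the cutoff where the distance is at most
    \<open>7*r/8\<close>.\<close>
  define c1 where "c1 = (r/8) powr (\<delta>/2 - 1)"
  define c2 where "c2 = (4/r) * r powr (\<delta>/2)"
  have c1: "0 < c1" and c2: "0 < c2" using r by (auto simp: c1_def c2_def)
  have "hardy_lhs \<Omega> \<delta> \<psi> \<le> a * hardy_rhs \<Omega> \<delta> \<psi> + (a * c2 + c1) * L2_norm \<Omega> \<psi>"
    if \<psi>: "\<psi> \<in> Cc1 \<Omega>" for \<psi>
  proof -
    define K where "K = closure {x. \<psi> x \<noteq> 0}"
    have K: "compact K" "K \<subseteq> \<Omega>" using \<psi> unfolding Cc1_def K_def by auto
    have notK: "\<psi> x = 0 \<and> grad \<psi> x = 0" if "x \<notin> K" for x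
      using Cc1_zero[OF \<psi>, of x] that unfolding K_def by simp
    obtain \<eta> X where \<eta>: "\<And>x. GDERIV \<eta> x :> X x" "continuous_on UNIV X"
      "\<And>x. 0 \<le> \<eta> x" "\<And>x. \<eta> x \<le> 1" "\<And>x. norm (X x) \<le> 4 / r"
      and one: "\<And>x. x \<in> K \<Longrightarrow> bdist \<Omega> x < r/8 \<Longrightarrow> \<eta> x = 1"
      and zero: "\<And>x. x \<in> K \<Longrightarrow> 7*r/8 < bdist \<Omega> x \<Longrightarrow> \<eta> x = 0 \<and> X x = 0"
      using cutoff_infdist[OF K(1) \<Omega>(2) r] unfolding bdist_def by metis
    define \<phi> where "\<phi> x = \<eta> x * \<psi> x" for x
    define \<Phi> where "\<Phi> x = \<eta> x *\<^sub>R grad \<psi> x + \<psi> x *\<^sub>R X x" for x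
    have D: "GDERIV \<phi> x :> \<Phi> x" for x
      unfolding \<phi>_def \<Phi>_def by (intro GDERIV_mult \<eta> Cc1_GDERIV[OF \<psi>])
    have grad: "grad \<phi> x = \<Phi> x" for x using D by (rule grad_eq)
    have \<phi>: "\<phi> \<in> Cc1 (bdry_layer \<Omega> r)"
    proof (rule Cc1_I[OF D])
      show "continuous_on UNIV \<Phi>"
        unfolding \<Phi>_def
        by (intro continuous_intros \<eta> GDERIV_continuous_on[OF \<eta>(1)]
            Cc1_continuous_on[OF \<psi>] Cc1_continuous_on_grad[OF \<psi>])
      \<comment> \<open>The margin between \<open>7*r/8\<close> and \<open>r\<close> provides a
        closed condition on the support that still implies the strict bound defining the
        layer.\<close>
      have "closed {x. bdist \<Omega> x \<le> 7*r/8}"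
        unfolding bdist_def by (intro closed_Collect_le continuous_intros)
      then show "compact (K \<inter> {x. bdist \<Omega> x \<le> 7*r/8})"
        using K by blast
      show "K \<inter> {x. bdist \<Omega> x \<le> 7*r/8} \<subseteq> bdry_layer \<Omega> r"
        using K r unfolding bdry_layer_def by auto
      show "x \<in> K \<inter> {x. bdist \<Omega> x \<le> 7*r/8}" if "\<phi> x \<noteq> 0" for x
      proof -
        have "x \<in> K" "\<eta> x \<noteq> 0" using that notK[of x] unfolding \<phi>_def by auto
        then show ?thesis using zero[of x] by force
      qed
    qed
    note int\<psi> = Cc1_set_integrable[OF \<Omega> \<psi> order_refl]
    note int\<phi> = Cc1_set_integrable[OF \<Omega> \<phi> bdry_layer_subset]
    have lhs: "hardy_lhs \<Omega> \<delta> \<psi> \<le> hardy_lhs \<Omega> \<delta> \<phi> + c1 * L2_norm \<Omega> \<psi>"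
      unfolding hardy_lhs_def
    proof (rule L2_norm_triangle[OF int\<phi>(2) int\<psi>(1)])
      fix x assume x: "x \<in> \<Omega>"
      show "norm (bdist \<Omega> x powr (\<delta>/2 - 1) * \<psi> x)
          \<le> norm (bdist \<Omega> x powr (\<delta>/2 - 1) * \<phi> x) + c1 * norm (\<psi> x)"
      \<comment> \<open>Either the weight is at most \<open>c1\<close>, or \<open>\<phi>\<close> and
        \<open>\<psi>\<close> agree at \<open>x\<close>: close to the boundary the cutoff is 1 on
        \<open>K\<close>, and off \<open>K\<close> both vanish.\<close>
      proof (cases "x \<in> K \<and> r/8 \<le> bdist \<Omega> x")
        case True
        then have "bdist \<Omega> x powr (\<delta>/2 - 1) \<le> c1"
          unfolding c1_def using r \<delta> by (intro powr_mono2') auto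
        then have "norm (bdist \<Omega> x powr (\<delta>/2 - 1) * \<psi> x) \<le> c1 * norm (\<psi> x)"
          by (simp add: abs_mult mult_right_mono)
        then show ?thesis by (simp add: add_increasing)
      next
        case False
        then have "\<phi> x = \<psi> x" using one[of x] notK[of x] unfolding \<phi>_def by force
        then show ?thesis using c1 by simp
      qed
    qed (use c1 in simp)
    have "hardy_lhs \<Omega> \<delta> \<phi> \<le> a * hardy_rhs \<Omega> \<delta> \<phi>"
      using hardy \<phi> unfolding hardy_ineq_def by blast
    also have "\<dots> \<le> a * (hardy_rhs \<Omega> \<delta> \<psi> + c2 * L2_norm \<Omega> \<psi>)"
      unfolding hardy_rhs_def
    proof (rule mult_left_mono[OF _ a], rule L2_norm_triangle[OF int\<psi>(3) int\<psi>(1)])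
      fix x assume x: "x \<in> \<Omega>"
      \<comment> \<open>This is the product-rule term \<open>\<psi> x *\<^sub>R X x\<close>: it
        vanishes off \<open>K\<close>, and on \<open>K\<close> beyond distance \<open>7*r/8\<close>,
        so the weight is only needed where it is bounded.\<close>
      have "bdist \<Omega> x powr (\<delta>/2) * (\<bar>\<psi> x\<bar> * norm (X x)) \<le> c2 * \<bar>\<psi> x\<bar>"
      proof (cases "x \<in> K \<and> bdist \<Omega> x \<le> 7*r/8")
        case True
        have "bdist \<Omega> x powr (\<delta>/2) \<le> r powr (\<delta>/2)"
          using True bdist_pos[OF \<Omega> x] \<delta> r by (intro powr_mono2) auto
        then have "bdist \<Omega> x powr (\<delta>/2) * (\<bar>\<psi> x\<bar> * norm (X x)) \<le> r powr (\<delta>/2) * (\<bar>\<psi> x\<bar> * (4/r))"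
          by (intro mult_mono \<eta>) auto
        then show ?thesis by (simp add: c2_def mult_ac)
      next
        case False
        then have "\<psi> x = 0 \<or> X x = 0" using zero[of x] notK[of x] by force
        then show ?thesis using c2 by auto
      qed
      moreover have "norm (\<Phi> x) \<le> norm (grad \<psi> x) + \<bar>\<psi> x\<bar> * norm (X x)"
      proof -
        have "norm (\<Phi> x) \<le> \<eta> x * norm (grad \<psi> x) + \<bar>\<psi> x\<bar> * norm (X x)"
          unfolding \<Phi>_def by (rule norm_triangle_le) (use \<eta>(3) in simp)
        moreover have "\<eta> x * norm (grad \<psi> x) \<le> norm (grad \<psi> x)"
          using \<eta>(3,4) by (simp add: mult_left_le_one_le)
        ultimately show ?thesis by linarith
      qed
      then have "bdist \<Omega> x powr (\<delta>/2) * norm (\<Phi> x)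
          \<le> bdist \<Omega> x powr (\<delta>/2) * (norm (grad \<psi> x) + \<bar>\<psi> x\<bar> * norm (X x))"
        by (intro mult_left_mono) auto
      ultimately show "norm (bdist \<Omega> x powr (\<delta>/2) *\<^sub>R grad \<phi> x)
          \<le> norm (bdist \<Omega> x powr (\<delta>/2) *\<^sub>R grad \<psi> x) + c2 * norm (\<psi> x)"
        unfolding grad by (simp add: distrib_left)
    qed (use c2 in simp)
    finally show ?thesis using lhs by (simp add: algebra_simps)
  qed
  moreover have "0 < a * c2 + c1" using a c1 c2 by (simp add: add_nonneg_pos)
  ultimately show ?thesis unfolding weak_hardy_ineq_def by blast
qed

text \<open>Any \<open>a\<close> above \<open>b\<close> is reached if the layer is thin enough,
  which is why the optimal constants agree in the limit. The set \<open>W\<close> allows the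
  argument to be localised.\<close>

lemma weak_hardy_imp_hardy_layer:
  fixes \<Omega> :: "'a::euclidean_space set"
  assumes \<Omega>: "open \<Omega>" "frontier \<Omega> \<noteq> {}" and \<delta>: "\<delta> < 2" and W: "W \<subseteq> \<Omega>"
    and b: "0 < b" "b < a" and c: "0 < c" and weak: "weak_hardy_ineq \<Omega> \<delta> W b c"
  shows "\<exists>s\<^sub>0>0. \<forall>s\<in>{0<..s\<^sub>0}. hardy_ineq \<Omega> \<delta> (bdry_layer \<Omega> s \<inter> W) a"
proof -
  define q where "q = 1 - \<delta>/2"
  have q: "0 < q" using \<delta> by (simp add: q_def)
  \<comment> \<open>Chosen so that \<open>c * \<theta> = 1 - b / a\<close>: absorbing this share of
    the left side leaves the factor \<open>b / a\<close> there. The layer width must then satisfy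
    \<open>s powr q \<le> \<theta>\<close>.\<close>
  define \<theta> where "\<theta> = (1 - b / a) / c"
  have \<theta>: "0 < \<theta>" using b c by (simp add: \<theta>_def)
  have "hardy_ineq \<Omega> \<delta> (bdry_layer \<Omega> s \<inter> W) a" if s: "0 < s" "s \<le> \<theta> powr (1/q)" for s
    unfolding hardy_ineq_def
  proof
    fix \<psi> assume \<psi>: "\<psi> \<in> Cc1 (bdry_layer \<Omega> s \<inter> W)"
    have sub: "bdry_layer \<Omega> s \<inter> W \<subseteq> \<Omega>" using W by auto
    have "L2_norm \<Omega> \<psi> \<le> s powr q * hardy_lhs \<Omega> \<delta> \<psi>"
      unfolding hardy_lhs_def
    proof (rule L2_norm_mono[OF Cc1_set_integrable(2)[OF \<Omega> \<psi> sub]])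
      fix x assume x: "x \<in> \<Omega>"
      show "norm (\<psi> x) \<le> s powr q * norm (bdist \<Omega> x powr (\<delta>/2 - 1) * \<psi> x)"
      proof (cases "\<psi> x = 0")
        case False
        then have "x \<in> closure {x. \<psi> x \<noteq> 0}" using closure_subset by fastforce
        then have d: "bdist \<Omega> x < s" using \<psi> unfolding Cc1_def bdry_layer_def by auto
        have d0: "0 < bdist \<Omega> x" by (rule bdist_pos[OF \<Omega> x])
        have "1 = bdist \<Omega> x powr q * bdist \<Omega> x powr (\<delta>/2 - 1)"
          using d0 by (simp add: powr_add[symmetric] q_def)
        also have "\<dots> \<le> s powr q * bdist \<Omega> x powr (\<delta>/2 - 1)"
          using d d0 q by (intro mult_right_mono powr_mono2) auto
        finally have "1 * \<bar>\<psi> x\<bar> \<le> s powr q * bdist \<Omega> x powr (\<delta>/2 - 1) * \<bar>\<psi> x\<bar>"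
          by (rule mult_right_mono) simp
        then show ?thesis by (simp add: abs_mult mult.assoc)
      qed simp
    qed simp
    also have "s powr q \<le> \<theta>"
    proof -
      have "s powr q \<le> (\<theta> powr (1/q)) powr q" using s q by (intro powr_mono2) auto
      then show ?thesis using q \<theta> by (simp add: powr_powr)
    qed
    finally have "L2_norm \<Omega> \<psi> \<le> \<theta> * hardy_lhs \<Omega> \<delta> \<psi>"
      by (simp add: mult_right_mono hardy_lhs_def L2_norm_nonneg)
    then have "c * L2_norm \<Omega> \<psi> \<le> c * (\<theta> * hardy_lhs \<Omega> \<delta> \<psi>)"
      using c by simp
    also have "\<dots> = (1 - b / a) * hardy_lhs \<Omega> \<delta> \<psi>"
      using c by (simp add: \<theta>_def)
    moreover have "hardy_lhs \<Omega> \<delta> \<psi> \<le> b * hardy_rhs \<Omega> \<delta> \<psi> + c * L2_norm \<Omega> \<psi>"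
      using weak_hardy_ineq_mono[OF weak, of "bdry_layer \<Omega> s \<inter> W"] \<psi>
      unfolding weak_hardy_ineq_def by blast
    ultimately have "b / a * hardy_lhs \<Omega> \<delta> \<psi> \<le> b * hardy_rhs \<Omega> \<delta> \<psi>"
      by (simp add: algebra_simps)
    then show "hardy_lhs \<Omega> \<delta> \<psi> \<le> a * hardy_rhs \<Omega> \<delta> \<psi>"
      using b by (simp add: field_simps)
  qed
  moreover have "0 < \<theta> powr (1/q)" using \<theta> by simp
  ultimately show ?thesis by (intro exI[of _ "\<theta> powr (1/q)"]) auto
qed

section \<open>Comparison of the optimal constants\<close>

lemma a_bdry_le:
  assumes "0 < a" "0 < r" "hardy_ineq \<Omega> \<delta> (bdry_layer \<Omega> r \<inter> U) a"
  shows "a_bdry \<Omega> \<delta> U \<le> ereal a"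
  unfolding a_bdry_def a_const_def
  using assms by (intro INF_lower2[of r] Inf_lower) auto

text \<open>Each \<open>b + e\<close> is a Hardy constant on some thinner layer, and
  \<open>a_bdry\<close> is an infimum over all widths, so \<open>e\<close> can tend to 0.\<close>

lemma a_bdry_le_of_weak_hardy:
  fixes \<Omega> :: "'a::euclidean_space set"
  assumes "open \<Omega>" "frontier \<Omega> \<noteq> {}" "\<delta> < 2" "0 < r" "0 < b" "0 < c"
    and weak: "weak_hardy_ineq \<Omega> \<delta> (bdry_layer \<Omega> r \<inter> U) b c"
  shows "a_bdry \<Omega> \<delta> U \<le> ereal b"
proof (rule ereal_le_epsilon2)
  fix e :: real assume "0 < e"
  then obtain s where s: "0 < s"
    "\<forall>s\<in>{0<..s}. hardy_ineq \<Omega> \<delta> (bdry_layer \<Omega> s \<inter> (bdry_layer \<Omega> r \<inter> U)) (b + e)"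
    using weak_hardy_imp_hardy_layer[OF assms(1-3) _ assms(5) _ assms(6) weak, of "b + e"]
      bdry_layer_subset[of \<Omega> r] by (auto simp: le_infI1)
  \<comment> \<open>With width \<open>min s r\<close> the new layer is contained in the given one,
    so intersecting with the latter changes nothing.\<close>
  have "bdry_layer \<Omega> (min s r) \<inter> (bdry_layer \<Omega> r \<inter> U) = bdry_layer \<Omega> (min s r) \<inter> U"
    unfolding bdry_layer_def by auto
  with s \<open>0 < r\<close> have "hardy_ineq \<Omega> \<delta> (bdry_layer \<Omega> (min s r) \<inter> U) (b + e)"
    by (metis greaterThanAtMost_iff min.cobounded1 min_less_iff_conj)
  then show "a_bdry \<Omega> \<delta> U \<le> ereal b + ereal e"
    using a_bdry_le[of "b + e" "min s r" \<Omega> \<delta> U] s \<open>0 < e\<close> assms by simp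
qed

text \<open>One direction absorbs the lower-order term on thinner layers; in the other, a Hardy
  inequality is a weak one with \<open>c = 1\<close>. Comparing infima of sets also covers the value
  infinity.\<close>

lemma a_bdry_eq_b_bdry:
  fixes \<Omega> :: "'a::euclidean_space set"
  assumes "open \<Omega>" "frontier \<Omega> \<noteq> {}" "\<delta> < 2"
  shows "a_bdry \<Omega> \<delta> U = b_bdry \<Omega> \<delta> U"
proof (rule antisym)
  show "a_bdry \<Omega> \<delta> U \<le> b_bdry \<Omega> \<delta> U"
    unfolding b_bdry_def b_const_def
    using a_bdry_le_of_weak_hardy[OF assms] by (auto intro!: INF_greatest Inf_greatest)
  have "{a. 0 < a \<and> hardy_ineq \<Omega> \<delta> W a} \<subseteq> {b. 0 < b \<and> (\<exists>c>0. weak_hardy_ineq \<Omega> \<delta> W b c)}" for W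
    using hardy_imp_weak_hardy_ineq[of \<Omega> \<delta> W _ 1] by (auto intro: exI[of _ 1])
  then show "b_bdry \<Omega> \<delta> U \<le> a_bdry \<Omega> \<delta> U"
    unfolding a_bdry_def b_bdry_def a_const_def b_const_def
    by (intro INF_mono' Inf_superset_mono image_mono)
qed

text \<open>Restricting a weak inequality to a layer preserves its constant. The reverse bound goes
  through \<open>a_bdry\<close>, since extension by cutoff starts from a Hardy inequality on the
  layer and keeps its leading constant.\<close>

lemma b_bdry_UNIV_eq_b_const:
  fixes \<Omega> :: "'a::euclidean_space set"
  assumes "open \<Omega>" "frontier \<Omega> \<noteq> {}" "0 \<le> \<delta>" "\<delta> < 2"
  shows "b_bdry \<Omega> \<delta> UNIV = b_const \<Omega> \<delta> \<Omega>"
proof (rule antisym)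
  have "b_const \<Omega> \<delta> (bdry_layer \<Omega> 1 \<inter> UNIV) \<le> b_const \<Omega> \<delta> \<Omega>"
    unfolding b_const_def
    using weak_hardy_ineq_mono[of \<Omega> \<delta> \<Omega> _ _ "bdry_layer \<Omega> 1"] bdry_layer_subset[of \<Omega> 1]
    by (intro Inf_superset_mono image_mono) auto
  then show "b_bdry \<Omega> \<delta> UNIV \<le> b_const \<Omega> \<delta> \<Omega>"
    unfolding b_bdry_def by (intro INF_lower2[of 1]) auto
  have "b_const \<Omega> \<delta> \<Omega> \<le> ereal a"
    if "0 < r" "0 < a" "hardy_ineq \<Omega> \<delta> (bdry_layer \<Omega> r) a" for r a
    using hardy_layer_imp_weak_hardy[OF assms that(1) _ that(3)] that(2)
    unfolding b_const_def by (intro Inf_lower) auto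
  then have "b_const \<Omega> \<delta> \<Omega> \<le> a_bdry \<Omega> \<delta> UNIV"
    unfolding a_bdry_def a_const_def by (auto intro!: INF_greatest Inf_greatest)
  then show "b_const \<Omega> \<delta> \<Omega> \<le> b_bdry \<Omega> \<delta> UNIV"
    using a_bdry_eq_b_bdry[OF assms(1,2,4)] by simp
qed

section \<open>Equivalence of the boundary and the weak Hardy inequality\<close>

lemma boundary_hardy_iff_weak_hardy:
  fixes \<Omega> :: "'a::euclidean_space set"
  assumes "open \<Omega>" "frontier \<Omega> \<noteq> {}" "0 \<le> \<delta>" "\<delta> < 2"
  shows "boundary_hardy \<Omega> \<delta> \<longleftrightarrow> weak_hardy \<Omega> \<delta>"
proof
  assume "boundary_hardy \<Omega> \<delta>"
  then obtain r\<^sub>0 where "0 < r\<^sub>0" and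
    bh: "\<forall>r\<in>{0<..<r\<^sub>0}. \<exists>a>0. hardy_ineq \<Omega> \<delta> (bdry_layer \<Omega> r) a"
    unfolding boundary_hardy_def by blast
  \<comment> \<open>One admissible layer is enough; the inequality is given only for widths strictly
    below \<open>r\<^sub>0\<close>.\<close>
  have "r\<^sub>0/2 \<in> {0<..<r\<^sub>0}" using \<open>0 < r\<^sub>0\<close> by simp
  then obtain a where "0 < a" "hardy_ineq \<Omega> \<delta> (bdry_layer \<Omega> (r\<^sub>0/2)) a"
    using bh by blast
  then show "weak_hardy \<Omega> \<delta>"
    using hardy_layer_imp_weak_hardy[OF assms, of "r\<^sub>0/2" a] \<open>0 < r\<^sub>0\<close>
    unfolding weak_hardy_def by auto
next
  assume "weak_hardy \<Omega> \<delta>"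
  then obtain b c where bc: "0 < b" "0 < c" "weak_hardy_ineq \<Omega> \<delta> \<Omega> b c"
    unfolding weak_hardy_def by blast
  \<comment> \<open>Any constant above \<open>b\<close> would serve; a single one then works for all
    layers up to width \<open>s\<^sub>0\<close>.\<close>
  obtain s\<^sub>0 where s: "0 < s\<^sub>0" "\<forall>s\<in>{0<..s\<^sub>0}. hardy_ineq \<Omega> \<delta> (bdry_layer \<Omega> s \<inter> \<Omega>) (b + 1)"
    using weak_hardy_imp_hardy_layer[OF assms(1,2,4) order_refl bc(1) _ bc(2,3), of "b + 1"]
    by auto
  have "bdry_layer \<Omega> s \<inter> \<Omega> = bdry_layer \<Omega> s" for s
    using bdry_layer_subset by blast
  then have "\<forall>s\<in>{0<..<s\<^sub>0}. hardy_ineq \<Omega> \<delta> (bdry_layer \<Omega> s) (b + 1)"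
    using s by simp
  moreover have "0 < b + 1" using bc by simp
  ultimately show "boundary_hardy \<Omega> \<delta>"
    unfolding boundary_hardy_def using s(1) by blast
qed

theorem proposition2p1:
  fixes \<Omega> :: "'a::euclidean_space set" and \<delta> :: real
  assumes "open \<Omega>" and "connected \<Omega>" and "frontier \<Omega> \<noteq> {}"
    and "0 \<le> \<delta>" and "\<delta> < 2"
  shows "(boundary_hardy \<Omega> \<delta> \<longleftrightarrow> weak_hardy \<Omega> \<delta>) \<and>
    (boundary_hardy \<Omega> \<delta> \<longrightarrow>
       a_bdry \<Omega> \<delta> UNIV = b_bdry \<Omega> \<delta> UNIV \<and> b_bdry \<Omega> \<delta> UNIV = b_const \<Omega> \<delta> \<Omega>) \<and>
    (\<forall>U. open U \<and> bounded U \<longrightarrow> a_bdry \<Omega> \<delta> U = b_bdry \<Omega> \<delta> U)"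
  by (simp add: boundary_hardy_iff_weak_hardy[OF assms(1,3-5)] a_bdry_eq_b_bdry[OF assms(1,3,5)]
      b_bdry_UNIV_eq_b_const[OF assms(1,3-5)])

end
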